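(* Let $S$ be a left cancellative monoid with neutral element $e$, and let $R$ be a ring with an $S$-grading $\Gamma: R=\bigoplus_{g\in S}R_g$ of finite support. Put $d=|\mathrm{Supp}(\Gamma)|$. If $R_e=\{0\}$, then $R^{d+1}=\{0\}$.
   Context: Rings are associative, not necessarily with unity. A monoid $S$ is left cancellative if $gh=gt$ implies $h=t$ for all $g,h,t\in S$. An $S$-grading on $R$ is a decomposition $\Gamma: R=\bigoplus_{g\in S}R_g$ into additive subgroups with $R_gR_h\subseteq R_{gh}$ for all $g,h\in S$; its support is $\mathrm{Supp}(\Gamma)=\{g\in S: R_g\neq 0\}$. $R^{n}=\{0\}$ means $a_1a_2\cdots a_n=0$ for all $a_1,\dots,a_n\in R$. *)

theory Defs
  imports Main
begin

text \<open>Rings are modelled by the class \<^class>\<open>ring\<close>, which is associative and does not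
  assume a unity.\<close>

definition left_cancellative :: "('s \<Rightarrow> 's \<Rightarrow> 's) \<Rightarrow> bool" where
  "left_cancellative m \<longleftrightarrow> (\<forall>g h t. m g h = m g t \<longrightarrow> h = t)"

definition add_subgroup :: "'r::ab_group_add set \<Rightarrow> bool" where
  "add_subgroup A \<longleftrightarrow>
     0 \<in> A \<and> (\<forall>x\<in>A. \<forall>y\<in>A. x + y \<in> A) \<and> (\<forall>x\<in>A. - x \<in> A)"

definition direct_sum_decomposition :: "('s \<Rightarrow> 'r::ab_group_add set) \<Rightarrow> bool" where
  "direct_sum_decomposition R \<longleftrightarrow>
     (\<forall>g. add_subgroup (R g)) \<and>
     (\<forall>r. \<exists>!f. (\<forall>g. f g \<in> R g) \<and> finite {g. f g \<noteq> 0} \<and> r = (\<Sum>g\<in>{g. f g \<noteq> 0}. f g))"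

definition grading :: "('s::monoid_mult \<Rightarrow> 'r::ring set) \<Rightarrow> bool" where
  "grading R \<longleftrightarrow>
     direct_sum_decomposition R \<and>
     (\<forall>g h. \<forall>x\<in>R g. \<forall>y\<in>R h. x * y \<in> R (g * h))"

definition grading_support :: "('s \<Rightarrow> 'r::ring set) \<Rightarrow> 's set" where
  "grading_support R = {g. R g \<noteq> {0}}"

text \<open>In the absence of a unity the product of a list is only meaningful for nonempty lists:
  \<open>list_product [a\<^sub>1, \<dots>, a\<^sub>n]\<close> is \<open>a\<^sub>1 * \<dots> * a\<^sub>n\<close> for \<open>n \<ge> 1\<close>, and its value on
  \<open>[]\<close> is unspecified.\<close>

definition list_product :: "'r::semigroup_mult list \<Rightarrow> 'r" where
  "list_product as = foldl (*) (hd as) (tl as)"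

end

theory Submission
  imports Defs
begin

text \<open>By additivity it suffices to multiply homogeneous elements \<open>a\<^sub>1, \<dots>, a\<^bsub>d+1\<^esub>\<close>, of degrees
  \<open>g\<^sub>1, \<dots>, g\<^bsub>d+1\<^esub>\<close>. If the product is nonzero, then all the prefix degrees \<open>g\<^sub>1\<cdots>g\<^sub>k\<close> lie in the
  support, so two of them coincide, say for \<open>i < j\<close>. Left cancellation gives \<open>g\<^bsub>i+1\<^esub>\<cdots>g\<^sub>j = 1\<close>,
  whence \<open>a\<^bsub>i+1\<^esub>\<cdots>a\<^sub>j\<close> lies in the zero component \<open>R 1\<close>, a contradiction.\<close>

lemma foldl_times_zero: "foldl (*) (0::'r::ring) as = 0"
  by (induction as) auto

lemma foldl_times_add:
  "foldl (*) (x + y :: 'r::ring) as = foldl (*) x as + foldl (*) y as"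
  by (induction as arbitrary: x y) (auto simp: distrib_right)

text \<open>Linearity in the accumulator lets the factors be split into homogeneous components one
  at a time, from left to right.\<close>

lemma foldl_times_sum:
  "foldl (*) (\<Sum>i\<in>I. f i :: 'r::ring) as = (\<Sum>i\<in>I. foldl (*) (f i) as)"
  by (induction I rule: infinite_finite_induct) (auto simp: foldl_times_zero foldl_times_add)

lemma grading_decompose:
  assumes "grading R"
  obtains f where "\<And>g. f g \<in> R g" "r = (\<Sum>g\<in>{g. f g \<noteq> 0}. f g)"
proof -
  have "\<exists>!f. (\<forall>g. f g \<in> R g) \<and> finite {g. f g \<noteq> 0} \<and> r = (\<Sum>g\<in>{g. f g \<noteq> 0}. f g)"
    using assms unfolding grading_def direct_sum_decomposition_def by blast
  then show thesis
    using that by blast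
qed

lemma grading_mult:
  assumes "grading R" "x \<in> R g" "y \<in> R h"
  shows "x * y \<in> R (g * h)"
  using assms unfolding grading_def by blast

lemma in_grading_support:
  assumes "x \<in> R g" "x \<noteq> 0"
  shows "g \<in> grading_support R"
  using assms by (auto simp: grading_support_def)

text \<open>The set \<open>V\<close> collects the degrees of the prefixes of a product \<open>x\<close> of homogeneous elements,
  remembering for each proper prefix \<open>y\<close> the cofactor \<open>z\<close>.\<close>

definition prefix_degrees :: "('s::monoid_mult \<Rightarrow> 'r::ring set) \<Rightarrow> 's set \<Rightarrow> 's \<Rightarrow> 'r \<Rightarrow> bool" where
  "prefix_degrees R V q x \<longleftrightarrow> x \<in> R q \<and> q \<in> V \<and> V \<subseteq> grading_support R \<and>
     (\<forall>p\<in>V. p = q \<or> (\<exists>u. \<exists>y\<in>R p. \<exists>z\<in>R u. p * u = q \<and> x = y * z))"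

text \<open>Each old prefix keeps its place, its cofactor being extended by \<open>w\<close>. Were
  \<open>q * h\<close> already in \<open>V\<close>, the cofactor completing that prefix to
  \<open>x * w\<close> would have degree \<open>1\<close> and hence vanish.\<close>

lemma prefix_degrees_mult:
  assumes canc: "left_cancellative ((*) :: 's \<Rightarrow> 's \<Rightarrow> 's)"
    and R: "grading (R :: 's::monoid_mult \<Rightarrow> 'r::ring set)" "R 1 = {0}"
    and V: "prefix_degrees R V q x" and w: "w \<in> R h" and nz: "x * w \<noteq> 0"
  shows "q * h \<notin> V" "prefix_degrees R (insert (q * h) V) (q * h) (x * w)"
proof -
  have x: "x \<in> R q" and sub: "V \<subseteq> grading_support R"
    and V': "\<And>p. p \<in> V \<Longrightarrow> p = q \<or> (\<exists>u. \<exists>y\<in>R p. \<exists>z\<in>R u. p * u = q \<and> x = y * z)"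
    using V unfolding prefix_degrees_def by auto
  have cofactor: "\<exists>u. \<exists>y\<in>R p. \<exists>z\<in>R u. p * u = q * h \<and> x * w = y * z" if "p \<in> V" for p
    using V'[OF that]
  proof
    assume "p = q"
    then show ?thesis using x w by blast
  next
    assume "\<exists>u. \<exists>y\<in>R p. \<exists>z\<in>R u. p * u = q \<and> x = y * z"
    then obtain u y z where "y \<in> R p" "z \<in> R u" "p * u = q" "x = y * z" by blast
    then have "z * w \<in> R (u * h)" "p * (u * h) = q * h" "x * w = y * (z * w)"
      using R(1) w by (auto simp: grading_mult mult.assoc)
    then show ?thesis using \<open>y \<in> R p\<close> by blast
  qed
  show "q * h \<notin> V"
  proof
    assume "q * h \<in> V"
    then obtain u y z where u: "z \<in> R u" "q * h * u = q * h" "x * w = y * z"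
      using cofactor by blast
    have "q * h * u = q * h * 1" using u(2) by simp
    then have "u = 1" using canc unfolding left_cancellative_def by blast
    then show False using u R(2) nz by simp
  qed
  have "x * w \<in> R (q * h)" using R(1) x w by (rule grading_mult)
  moreover from this have "q * h \<in> grading_support R" using nz by (rule in_grading_support)
  ultimately show "prefix_degrees R (insert (q * h) V) (q * h) (x * w)"
    using sub cofactor by (simp add: prefix_degrees_def)
qed

text \<open>Each factor that keeps the product nonzero moves one unit from \<open>length as\<close>
  to \<open>card V\<close>, so the strict bound survives until the list is empty, where
  \<open>V\<close> would outgrow the support.\<close>

lemma foldl_times_eq_0_of_prefix_degrees:
  assumes canc: "left_cancellative ((*) :: 's \<Rightarrow> 's \<Rightarrow> 's)"
    and R: "grading (R :: 's::monoid_mult \<Rightarrow> 'r::ring set)" "R 1 = {0}"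
    and fin: "finite (grading_support R)"
    and "prefix_degrees R V q x" "card (grading_support R) < card V + length as"
  shows "foldl (*) x as = 0"
  using assms(5,6)
proof (induction as arbitrary: V q x)
  case Nil
  have "card V \<le> card (grading_support R)"
    using Nil(1) fin by (intro card_mono) (auto simp: prefix_degrees_def)
  then show ?case using Nil(2) by simp
next
  case (Cons w as)
  obtain f where f: "\<And>g. f g \<in> R g" "w = (\<Sum>g\<in>{g. f g \<noteq> 0}. f g)"
    using grading_decompose[OF R(1), where r = w] by blast
  have "foldl (*) (x * f h) as = 0" for h
  proof (cases "x * f h = 0")
    case True
    then show ?thesis by (simp add: foldl_times_zero)
  next
    case False
    note step = prefix_degrees_mult[OF canc R Cons.prems(1) f(1) False]
    \<comment> \<open>Only for finite \<open>V\<close> does inserting the new degree raise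
      \<open>card V\<close> by one.\<close>
    have "finite V"
      using Cons.prems(1) fin by (auto simp: prefix_degrees_def intro: finite_subset)
    then show ?thesis
      using Cons.IH[OF step(2)] step(1) Cons.prems(2) by simp
  qed
  then have "foldl (*) (\<Sum>h\<in>{g. f g \<noteq> 0}. x * f h) as = 0"
    by (simp add: foldl_times_sum)
  then show ?case
    by (subst f(2)) (simp add: sum_distrib_left)
qed

theorem proposition3p2:
  fixes R :: "'s::monoid_mult \<Rightarrow> 'r::ring set"
    and d :: nat
  assumes "left_cancellative ((*) :: 's \<Rightarrow> 's \<Rightarrow> 's)"
    and "grading R"
    and "finite (grading_support R)"
    and "d = card (grading_support R)"
    and "R 1 = {0}"
  shows "\<forall>as :: 'r list. length as = d + 1 \<longrightarrow> list_product as = 0"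
proof (intro allI impI)
  fix as :: "'r list"
  assume "length as = d + 1"
  then obtain a bs where as: "as = a # bs" "length bs = d"
    by (cases as) auto
  obtain f where f: "\<And>g. f g \<in> R g" "a = (\<Sum>g\<in>{g. f g \<noteq> 0}. f g)"
    using grading_decompose[OF assms(2), where r = a] by blast
  have "foldl (*) (f g) bs = 0" if "f g \<noteq> 0" for g
  proof (rule foldl_times_eq_0_of_prefix_degrees[OF assms(1,2,5,3)])
    \<comment> \<open>The first factor already contributes one degree, so the count starts at
      \<open>1 + d\<close>, just above \<open>d\<close>.\<close>
    show "prefix_degrees R {g} g (f g)"
      using f(1) in_grading_support[of "f g" R g] that by (simp add: prefix_degrees_def)
  qed (use as(2) assms(4) in simp)
  then have "foldl (*) a bs = 0"
    by (subst f(2)) (simp add: foldl_times_sum)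
  then show "list_product as = 0"
    by (simp add: as list_product_def)
qed

end
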